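(* Let $X$ and $Y$ be Polish spaces, $\pi\colon X\to Y$ continuous, $L\colon X\to\overline{\mathbb R}_+$ lower semicontinuous, $H\colon X\times X\to\overline{\mathbb R}_+$ Borel measurable, and $m_0\in\mathcal P(Y)$. Assume that the function $(x,\tilde x)\mapsto L(x)+L(\tilde x)+H(x,\tilde x)$ is lower semicontinuous on $X\times X$, and that, for every $Q\in\mathcal P(X)$ with $\int_X L\,\mathrm dQ<+\infty$, the set $$\mathbf{Opt}(Q)=\Bigl\{x\in X : F(x,Q)=\inf_{\tilde x\in X,\ \pi(\tilde x)=\pi(x)}F(\tilde x,Q)\Bigr\}$$ is closed in $X$. Then $Q\in\mathcal P(X)$ with $\pi_\#Q=m_0$ is an equilibrium of $\mathrm{NAG}(X,Y,\pi,L,H,m_0)$ if and only if it is a strong equilibrium of $\mathrm{NAG}(X,Y,\pi,L,H,m_0)$.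
   Context: $\overline{\mathbb R}_+=[0,+\infty]$; $\mathcal P(X)$ is the set of Borel probability measures on $X$; $\pi_\#Q$ denotes the pushforward; the support $\operatorname{spt}(Q)$ is the set of $x\in X$ all of whose neighborhoods have positive $Q$-measure. Individual cost: $F(x,Q)=L(x)+\int_X H(x,\tilde x)\,\mathrm dQ(\tilde x)$ for $x\in X$, $Q\in\mathcal P(X)$. Equilibrium: $Q\in\mathcal P(X)$ is an equilibrium of $\mathrm{NAG}(X,Y,\pi,L,H,m_0)$ if $\pi_\#Q=m_0$, $\int_X F(x,Q)\,\mathrm dQ(x)<+\infty$, and for $Q$-almost every $x\in X$ one has $F(x,Q)=\inf\{F(z,Q): z\in X,\ \pi(z)=\pi(x)\}$. Strong equilibrium: the same definition with "for $Q$-almost every $x\in X$" replaced by "for every $x\in\operatorname{spt}(Q)$". *)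

theory Defs
  imports "HOL-Probability.Probability"
begin

abbreviation borel_probs :: "'a::topological_space measure set" where
  "borel_probs \<equiv> space (prob_algebra borel)"

definition lower_semicontinuous :: "('a::topological_space \<Rightarrow> ennreal) \<Rightarrow> bool" where
  "lower_semicontinuous f \<longleftrightarrow> (\<forall>x. \<forall>c < f x. eventually (\<lambda>y. c < f y) (nhds x))"

(* Quantifying over open neighbourhoods only is deliberate: emeasure is 0 on non-measurable
   sets, and an arbitrary neighbourhood need not be Borel. *)
definition spt :: "'a::topological_space measure \<Rightarrow> 'a set" where
  "spt Q = {x. \<forall>U. open U \<and> x \<in> U \<longrightarrow> emeasure Q U > 0}"

definition indiv_cost ::
    "('x \<Rightarrow> ennreal) \<Rightarrow> ('x \<times> 'x \<Rightarrow> ennreal) \<Rightarrow> 'x \<Rightarrow> 'x measure \<Rightarrow> ennreal" where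
  "indiv_cost L H x Q = L x + (\<integral>\<^sup>+ x'. H (x, x') \<partial>Q)"

definition Opt ::
    "('x \<Rightarrow> 'y) \<Rightarrow> ('x \<Rightarrow> ennreal) \<Rightarrow> ('x \<times> 'x \<Rightarrow> ennreal) \<Rightarrow> 'x measure \<Rightarrow> 'x set" where
  "Opt p L H Q = {x. indiv_cost L H x Q = (INF z\<in>{z. p z = p x}. indiv_cost L H z Q)}"

definition equilibrium ::
    "('x::topological_space \<Rightarrow> 'y::topological_space) \<Rightarrow> ('x \<Rightarrow> ennreal) \<Rightarrow>
      ('x \<times> 'x \<Rightarrow> ennreal) \<Rightarrow> 'y measure \<Rightarrow> 'x measure \<Rightarrow> bool" where
  "equilibrium p L H m0 Q \<longleftrightarrow>
    Q \<in> borel_probs \<and> distr Q borel p = m0 \<and>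
    (\<integral>\<^sup>+ x. indiv_cost L H x Q \<partial>Q) < \<infinity> \<and>
    (AE x in Q. indiv_cost L H x Q = (INF z\<in>{z. p z = p x}. indiv_cost L H z Q))"

definition strong_equilibrium ::
    "('x::topological_space \<Rightarrow> 'y::topological_space) \<Rightarrow> ('x \<Rightarrow> ennreal) \<Rightarrow>
      ('x \<times> 'x \<Rightarrow> ennreal) \<Rightarrow> 'y measure \<Rightarrow> 'x measure \<Rightarrow> bool" where
  "strong_equilibrium p L H m0 Q \<longleftrightarrow>
    Q \<in> borel_probs \<and> distr Q borel p = m0 \<and>
    (\<integral>\<^sup>+ x. indiv_cost L H x Q \<partial>Q) < \<infinity> \<and>
    (\<forall>x\<in>spt Q. indiv_cost L H x Q = (INF z\<in>{z. p z = p x}. indiv_cost L H z Q))"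

end

theory Submission
  imports Defs
begin

text \<open>
  An equilibrium has finite total cost, so \<open>L\<close> is \<open>Q\<close>-integrable and \<open>Opt(Q)\<close> is closed. A closed
  set of full measure contains the support; conversely, in a second countable space the support
  itself has full measure.
\<close>

text \<open>The complement of \<open>C\<close> is open and null, so a point outside \<open>C\<close>
  has a neighbourhood of measure zero.\<close>

lemma AE_in_closed_imp_spt_subset:
  assumes sets: "sets Q = sets borel" and "closed C" and AE: "AE x in Q. x \<in> C"
  shows "spt Q \<subseteq> C"
proof
  fix x assume x: "x \<in> spt Q"
  have "- C \<in> sets Q"
    using \<open>closed C\<close> by (simp add: sets open_Compl)
  then have "emeasure Q (- C) = 0"
    using AE by (subst (asm) AE_iff_measurable[where N = "- C"]) (auto simp: sets_eq_imp_space_eq[OF sets])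
  then show "x \<in> C"
    using x \<open>closed C\<close> by (force simp: spt_def)
qed

text \<open>The complement of the support is covered by the null members of a countable basis, and
  countably many null sets have a null union.\<close>

lemma AE_in_spt:
  fixes Q :: "'a::second_countable_topology measure"
  assumes sets: "sets Q = sets borel"
  shows "AE x in Q. x \<in> spt Q"
proof -
  obtain \<B> :: "'a set set" where \<B>: "countable \<B>" "topological_basis \<B>"
    using ex_countable_basis by blast
  have "AE x in Q. x \<notin> B" if "B \<in> \<B>" "emeasure Q B = 0" for B
    using that topological_basis_open[OF \<B>(2)]
    by (intro AE_not_in) (simp add: null_sets_def sets)
  then have "AE x in Q. \<forall>B\<in>{B\<in>\<B>. emeasure Q B = 0}. x \<notin> B"
    using \<B>(1) by (subst AE_ball_countable) auto
  then show ?thesis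
  proof eventually_elim
    case (elim x)
    \<comment> \<open>A basic set \<open>B\<close> with \<open>x\<close> in \<open>B\<close> and
      \<open>B\<close> inside \<open>U\<close> cannot be null, since \<open>x\<close> avoids all
      null basic sets.\<close>
    have "emeasure Q U > 0" if U: "open U" "x \<in> U" for U
    proof -
      obtain B where B: "B \<in> \<B>" "x \<in> B" "B \<subseteq> U"
        using topological_basisE[OF \<B>(2) U] by blast
      have "0 < emeasure Q B"
        using elim B by (auto simp: zero_less_iff_neq_zero)
      also have "\<dots> \<le> emeasure Q U"
        using B U by (intro emeasure_mono) (auto simp: sets)
      finally show ?thesis .
    qed
    then show ?case by (simp add: spt_def)
  qed
qed

theorem theorem3p27:
  fixes p :: "'x::polish_space \<Rightarrow> 'y::polish_space"
    and L :: "'x \<Rightarrow> ennreal"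
    and H :: "'x \<times> 'x \<Rightarrow> ennreal"
    and m0 :: "'y measure"
    and Q :: "'x measure"
  assumes "continuous_on UNIV p"
    and "lower_semicontinuous L"
    and "H \<in> borel_measurable borel"
    and "m0 \<in> borel_probs"
    and "lower_semicontinuous (\<lambda>(x, x'). L x + L x' + H (x, x'))"
    and "\<And>R. R \<in> borel_probs \<Longrightarrow> (\<integral>\<^sup>+ x. L x \<partial>R) < \<infinity> \<Longrightarrow> closed (Opt p L H R)"
    and "Q \<in> borel_probs"
    and "distr Q borel p = m0"
  shows "equilibrium p L H m0 Q \<longleftrightarrow> strong_equilibrium p L H m0 Q"
proof -
  have sets: "sets Q = sets borel"
    using assms(7) by (simp add: space_prob_algebra)
  \<comment> \<open>Both notions include finite total cost and differ only in the optimality clause,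
    so the two clauses need comparing only under \<open>fin\<close>.\<close>
  have "(AE x in Q. x \<in> Opt p L H Q) \<longleftrightarrow> (\<forall>x\<in>spt Q. x \<in> Opt p L H Q)"
    if fin: "(\<integral>\<^sup>+ x. indiv_cost L H x Q \<partial>Q) < \<infinity>"
  proof
    \<comment> \<open>The interaction term is nonnegative, so \<open>L\<close> is bounded by the
      individual cost; this makes the closedness hypothesis applicable to \<open>Q\<close>.\<close>
    have "(\<integral>\<^sup>+ x. L x \<partial>Q) \<le> (\<integral>\<^sup>+ x. indiv_cost L H x Q \<partial>Q)"
      by (intro nn_integral_mono) (simp add: indiv_cost_def)
    then have "closed (Opt p L H Q)"
      using fin assms(6,7) by (meson le_less_trans)
    then show "\<forall>x\<in>spt Q. x \<in> Opt p L H Q" if "AE x in Q. x \<in> Opt p L H Q"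
      using AE_in_closed_imp_spt_subset[OF sets _ that] by blast
  next
    show "AE x in Q. x \<in> Opt p L H Q" if "\<forall>x\<in>spt Q. x \<in> Opt p L H Q"
      using AE_in_spt[OF sets] that by (auto elim: eventually_mono)
  qed
  then show ?thesis
    by (auto simp: equilibrium_def strong_equilibrium_def Opt_def)
qed

end
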